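(* Let $p\in[1,\infty]$, $p^{-1}+q^{-1}=1$, and assume $\max\{\|f\|_p,\|f_1\|_p,\dots,\|f_N\|_p\}=:L<\infty$. Let $\Lambda_\varepsilon$ be a minimal $\varepsilon$-net of $\Lambda$ in the $l_1$-norm, and assume that the (finite) set of probe functions $\Psi_{\Lambda_\varepsilon}$ is $(0,p)$-good with respect to $\mathcal{G}_{\Lambda_\varepsilon}$. Let $\delta\in(0,1)$ and $$\varkappa=\varkappa(\delta,\Psi_{\Lambda_\varepsilon}):=\min\Big\{\varkappa>0:\mathbb{P}\Big[\max_{\psi\in\Psi_{\Lambda_\varepsilon}}\frac{|Z(\psi)|}{\|\psi\|_2}\ge\varkappa\Big]\le\delta\Big\}.$$ Let $$\hat\lambda:=\arg\min_{\lambda\in\Lambda}\max_{\psi\in\Psi_{\Lambda_\varepsilon}}\Big\{\frac{1}{\|\psi\|_q}\big[|\Delta_\lambda(\psi)|-\varepsilon\varkappa\|\psi\|_2\big]\Big\},\qquad\hat F:=F_{\hat\lambda}.$$ Then $$\mathcal{R}_p[\hat F;f]\le\Big(2\max_{\psi\in\Psi_{\Lambda_\varepsilon}}\|\psi\|_q+1\Big)\min_{\lambda\in\Lambda}\|f-F_\lambda\|_p+2\varkappa\varepsilon\max_{\psi\in\Psi_{\Lambda_\varepsilon}}\|\psi\|_2+2L\varepsilon\Big(1+\max_{\psi\in\Psi_{\Lambda_\varepsilon}}\|\psi\|_q\Big)+2L\delta .$$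
   Context: Model: $\mathcal{D}_0=[0,1]^d$, $\varepsilon\in(0,1)$, and one observes $\mathcal{Y}_\varepsilon$ in the Gaussian white noise model $Y_\varepsilon(dt)=f(t)\,dt+\varepsilon W(dt)$, $t\in\mathcal{D}_0$, with $f$ an unknown real function and $W$ the standard Wiener process in $\mathbb{R}^d$. Thus for a probe function $\psi\in\mathbb{L}_2(\mathcal{D}_0)$ one observes $\int\psi(t)Y_\varepsilon(dt)=\int\psi f\,dt+\varepsilon Z(\psi)$, where $Z(\psi)=\int\psi(t)W(dt)$ is the zero-mean Gaussian process, linear in $\psi$, with $\mathbb{E}[Z(\psi)Z(\phi)]=\int\psi\phi\,dt$. $\|\cdot\|_p$ is the $\mathbb{L}_p$-norm on $\mathcal{D}_0$; $\mathcal{R}_p[\tilde f;f]:=\mathbb{E}_f\|\tilde f-f\|_p$, with $\mathbb{E}_f$ the expectation under the model with signal $f$. Convex aggregation: $f_1,\dots,f_N$ are fixed (nonrandom) functions on $\mathcal{D}_0$; $\Lambda=\{\lambda\in\mathbb{R}^N:\lambda_i\ge0,\ \sum_{i=1}^N\lambda_i\le1\}$; $F_\lambda(t)=\sum_{i=1}^N\lambda_if_i(t)$. An $\varepsilon$-net $\Lambda_\varepsilon\subset\Lambda$ in $l_1$-norm is a finite set such that every $\lambda\in\Lambda$ has some $\lambda'\in\Lambda_\varepsilon$ with $\sum_i|\lambda_i-\lambda_i'|\le\varepsilon$; minimal means of smallest cardinality. $\mathcal{G}_{\Lambda_\varepsilon}=\{F_\lambda-F_\nu:\lambda,\nu\in\Lambda_\varepsilon,\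 \lambda\ne\nu\}$ (pairs with $F_\lambda=F_\nu$ being disregarded). A set $\Psi$ of functions is $(\gamma,p)$-good with respect to a set $\mathcal{G}$ of functions if for every $g\in\mathcal{G}$ there is $\psi_g\in\Psi$ with $\big|\int\psi_g(t)g(t)\,dt-\|g\|_p\big|\le\gamma$. $\Psi_{\Lambda_\varepsilon}$ consists of such representers $\psi_g$, one for each $g\in\mathcal{G}_{\Lambda_\varepsilon}$. $\Delta_\lambda(\psi):=\int\psi(t)Y_\varepsilon(dt)-\int\psi(t)F_\lambda(t)\,dt=\int\psi(t)[f(t)-F_\lambda(t)]\,dt+\varepsilon Z(\psi)$. Conventions: $\Psi_{\Lambda_\varepsilon}$ is nonempty, probe functions are nonzero, and all integrals and norms appearing are finite; $\hat\lambda$ is a measurable minimizer. *)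

theory Defs
  imports "HOL-Probability.Probability"
begin

abbreviation unit_cube :: "(real^'d::finite) measure" where
  "unit_cube \<equiv> lebesgue_on (cbox 0 1)"

text \<open>
  The exponent ranges over \<^typ>\<open>ennreal\<close>, so that \<open>p = \<infinity>\<close> is allowed and conjugacy reads
  \<open>inverse p + inverse q = 1\<close>. The real number \<open>Lp_norm p f\<close> is meaningful only
  for \<open>f \<in> Lp_space p\<close>; no quotient by almost everywhere equality is taken.
\<close>

definition Lp_space :: "ennreal \<Rightarrow> (real^'d::finite \<Rightarrow> real) set" where
  "Lp_space p = {f \<in> borel_measurable unit_cube.
     if p = \<infinity> then esssup unit_cube (\<lambda>t. ereal \<bar>f t\<bar>) < \<infinity>
     else integrable unit_cube (\<lambda>t. \<bar>f t\<bar> powr enn2real p)}"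

definition Lp_norm :: "ennreal \<Rightarrow> (real^'d::finite \<Rightarrow> real) \<Rightarrow> real" where
  "Lp_norm p f =
     (if p = \<infinity> then real_of_ereal (esssup unit_cube (\<lambda>t. ereal \<bar>f t\<bar>))
      else (\<integral>t. \<bar>f t\<bar> powr enn2real p \<partial>unit_cube) powr (1 / enn2real p))"

definition pairing :: "(real^'d::finite \<Rightarrow> real) \<Rightarrow> (real^'d \<Rightarrow> real) \<Rightarrow> real" where
  "pairing \<psi> g = (\<integral>t. \<psi> t * g t \<partial>unit_cube)"

text \<open>Degenerate (almost surely constant) variables count as Gaussian.\<close>

definition gaussian_rv :: "'w measure \<Rightarrow> ('w \<Rightarrow> real) \<Rightarrow> bool" where
  "gaussian_rv M X \<longleftrightarrow> X \<in> borel_measurable M \<and>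
     ((\<exists>\<mu>. AE \<omega> in M. X \<omega> = \<mu>) \<or>
      (\<exists>\<mu> \<sigma>. 0 < \<sigma> \<and> distributed M lborel X (\<lambda>x. ennreal (normal_density \<mu> \<sigma> x))))"

definition gaussian_process :: "'w measure \<Rightarrow> 'i set \<Rightarrow> ('i \<Rightarrow> 'w \<Rightarrow> real) \<Rightarrow> bool" where
  "gaussian_process M I X \<longleftrightarrow>
     (\<forall>J a. finite J \<longrightarrow> J \<subseteq> I \<longrightarrow> gaussian_rv M (\<lambda>\<omega>. \<Sum>j\<in>J. a j * X j \<omega>))"

text \<open>
  \<open>Z \<psi>\<close> is the stochastic integral of \<open>\<psi>\<close> against the Wiener process. As it is determined only
  up to null events, linearity is required almost surely.
\<close>

definition white_noise ::
    "'w measure \<Rightarrow> ((real^'d::finite \<Rightarrow> real) \<Rightarrow> 'w \<Rightarrow> real) \<Rightarrow> bool" where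
  "white_noise M Z \<longleftrightarrow>
     prob_space M \<and>
     gaussian_process M (Lp_space 2) Z \<and>
     (\<forall>\<psi>\<in>Lp_space 2. (\<integral>\<omega>. Z \<psi> \<omega> \<partial>M) = 0) \<and>
     (\<forall>\<psi>\<in>Lp_space 2. \<forall>\<phi>\<in>Lp_space 2.
        (\<integral>\<omega>. Z \<psi> \<omega> * Z \<phi> \<omega> \<partial>M) = pairing \<psi> \<phi>) \<and>
     (\<forall>\<psi>\<in>Lp_space 2. \<forall>\<phi>\<in>Lp_space 2. \<forall>a b.
        AE \<omega> in M. Z (\<lambda>t. a * \<psi> t + b * \<phi> t) \<omega> = a * Z \<psi> \<omega> + b * Z \<phi> \<omega>)"

text \<open>The observation of \<open>\<psi>\<close> in the model \<open>Y(dt) = f(t) dt + \<epsilon> W(dt)\<close>.\<close>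

definition observation ::
    "((real^'d::finite \<Rightarrow> real) \<Rightarrow> 'w \<Rightarrow> real) \<Rightarrow> real \<Rightarrow> (real^'d \<Rightarrow> real) \<Rightarrow>
      (real^'d \<Rightarrow> real) \<Rightarrow> 'w \<Rightarrow> real" where
  "observation Z \<epsilon> f \<psi> \<omega> = pairing \<psi> f + \<epsilon> * Z \<psi> \<omega>"

definition risk ::
    "'w measure \<Rightarrow> ennreal \<Rightarrow> ('w \<Rightarrow> real^'d::finite \<Rightarrow> real) \<Rightarrow> (real^'d \<Rightarrow> real) \<Rightarrow> ennreal" where
  "risk M p fhat f = (\<integral>\<^sup>+\<omega>. ennreal (Lp_norm p (\<lambda>t. fhat \<omega> t - f t)) \<partial>M)"

definition weights :: "(real^'n::finite) set" where
  "weights = {l. (\<forall>i. 0 \<le> l $ i) \<and> (\<Sum>i\<in>UNIV. l $ i) \<le> 1}"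

definition aggregate ::
    "('n::finite \<Rightarrow> real^'d::finite \<Rightarrow> real) \<Rightarrow> real^'n \<Rightarrow> real^'d \<Rightarrow> real" where
  "aggregate fs l t = (\<Sum>i\<in>UNIV. l $ i * fs i t)"

definition l1_net :: "real \<Rightarrow> (real^'n::finite) set \<Rightarrow> bool" where
  "l1_net \<epsilon> S \<longleftrightarrow> finite S \<and> S \<subseteq> weights \<and>
     (\<forall>l\<in>weights. \<exists>l'\<in>S. (\<Sum>i\<in>UNIV. \<bar>l $ i - l' $ i\<bar>) \<le> \<epsilon>)"

definition minimal_l1_net :: "real \<Rightarrow> (real^'n::finite) set \<Rightarrow> bool" where
  "minimal_l1_net \<epsilon> S \<longleftrightarrow> l1_net \<epsilon> S \<and>
     (\<forall>S' :: (real^'n) set. l1_net \<epsilon> S' \<longrightarrow> card S \<le> card S')"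

text \<open>Pairs whose aggregates coincide, as elements of \<open>L\<^sub>p\<close> (almost everywhere), are disregarded.\<close>

definition differences ::
    "('n::finite \<Rightarrow> real^'d::finite \<Rightarrow> real) \<Rightarrow> (real^'n) set \<Rightarrow> (real^'d \<Rightarrow> real) set" where
  "differences fs S =
     {\<lambda>t. aggregate fs l t - aggregate fs m t | l m.
        l \<in> S \<and> m \<in> S \<and> l \<noteq> m \<and>
        \<not> (AE t in unit_cube. aggregate fs l t = aggregate fs m t)}"

definition represents ::
    "real \<Rightarrow> ennreal \<Rightarrow> (real^'d::finite \<Rightarrow> real) \<Rightarrow> (real^'d \<Rightarrow> real) \<Rightarrow> bool" where
  "represents \<gamma> p \<psi> g \<longleftrightarrow> \<bar>pairing \<psi> g - Lp_norm p g\<bar> \<le> \<gamma>"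

definition good ::
    "real \<Rightarrow> ennreal \<Rightarrow> (real^'d::finite \<Rightarrow> real) set \<Rightarrow> (real^'d \<Rightarrow> real) set \<Rightarrow> bool" where
  "good \<gamma> p \<Psi> G \<longleftrightarrow> (\<forall>g\<in>G. \<exists>\<psi>\<in>\<Psi>. represents \<gamma> p \<psi> g)"

definition consists_of_representers ::
    "real \<Rightarrow> ennreal \<Rightarrow> (real^'d::finite \<Rightarrow> real) set \<Rightarrow> (real^'d \<Rightarrow> real) set \<Rightarrow> bool" where
  "consists_of_representers \<gamma> p \<Psi> G \<longleftrightarrow>
     (\<exists>rep. \<Psi> = rep ` G \<and> (\<forall>g\<in>G. represents \<gamma> p (rep g) g))"

definition critical_value ::
    "'w measure \<Rightarrow> ((real^'d::finite \<Rightarrow> real) \<Rightarrow> 'w \<Rightarrow> real) \<Rightarrow> (real^'d \<Rightarrow> real) set \<Rightarrow>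
      real \<Rightarrow> real" where
  "critical_value M Z \<Psi> \<delta> =
     (LEAST k. 0 < k \<and>
        measure M {\<omega> \<in> space M. k \<le> (MAX \<psi>\<in>\<Psi>. \<bar>Z \<psi> \<omega>\<bar> / Lp_norm 2 \<psi>)} \<le> \<delta>)"

text \<open>In the next two definitions \<open>y \<psi>\<close> is the observed value for the probe function \<open>\<psi>\<close>.\<close>

definition discrepancy ::
    "('n::finite \<Rightarrow> real^'d::finite \<Rightarrow> real) \<Rightarrow> ((real^'d \<Rightarrow> real) \<Rightarrow> real) \<Rightarrow> real^'n \<Rightarrow>
      (real^'d \<Rightarrow> real) \<Rightarrow> real" where
  "discrepancy fs y l \<psi> = y \<psi> - pairing \<psi> (aggregate fs l)"

definition criterion ::
    "ennreal \<Rightarrow> real \<Rightarrow> real \<Rightarrow> (real^'d::finite \<Rightarrow> real) set \<Rightarrow>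
      ('n::finite \<Rightarrow> real^'d \<Rightarrow> real) \<Rightarrow> ((real^'d \<Rightarrow> real) \<Rightarrow> real) \<Rightarrow> real^'n \<Rightarrow> real" where
  "criterion q \<epsilon> \<kappa> \<Psi> fs y l =
     (MAX \<psi>\<in>\<Psi>. 1 / Lp_norm q \<psi> * (\<bar>discrepancy fs y l \<psi>\<bar> - \<epsilon> * \<kappa> * Lp_norm 2 \<psi>))"

end

theory Submission
  imports Defs
begin

text \<open>
  The theorem is a deterministic comparison on the event that the normalised noise stays below the
  critical value \<open>\<kappa>\<close>, combined with a crude bound on the complement.

  On this event, let \<open>l\<close> be a best weight, with approximation error \<open>d\<close>. The criterion subtracts
  from every discrepancy the largest noise that can occur and divides by \<open>Lp_norm q \<psi>\<close>, so
  Hoelder's inequality bounds the criterion at \<open>l\<close> by \<open>d\<close>, and hence also the criterion at the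
  minimizer. The two aggregates thus explain the same observations, and their difference has pairing
  at most \<open>2 * Lp_norm q \<psi> * d + 2 * \<epsilon> * \<kappa> * Lp_norm 2 \<psi>\<close> with every probe function
  (\<open>discrepancy_minimizer_le\<close>). Probe functions recover the norms of differences of net points, and
  aggregates depend on their weights in a Lipschitz way, so bounds on the pairings yield a bound on
  the norm of the difference, at the price \<open>2 * L * \<epsilon> * (1 + Q)\<close>, where \<open>Q\<close> is the largest
  \<open>Lp_norm q \<psi>\<close> (\<open>norm_le_of_pairings_on_net\<close>). The triangle inequality adds the last \<open>d\<close>.

  Whatever the noise, signal and aggregate lie in the ball of radius \<open>L\<close>, so the loss is at most
  \<open>2 * L\<close>. The complement of the event has probability at most \<open>\<delta>\<close>, provided that the minimum defining \<open>\<kappa>\<close> is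
  attained. It is, because the noise variables of nonzero probe functions are nondegenerate Gaussian
  and the law of their normalised maximum has no atoms (\<open>critical_value_controls_noise\<close>).

  The analysis rests on the inequalities of Minkowski and Hoelder for all exponents in \<open>[1, \<infinity>]\<close>.
\<close>

section \<open>Inequalities of Minkowski and Hoelder on the unit cube\<close>

text \<open>
  Convexity of \<open>x \<mapsto> x powr P\<close> up to the boundary point \<open>0\<close>: when one of the two points is \<open>0\<close>,
  the claim says that \<open>c powr P \<le> c\<close> for a weight \<open>c\<close> in \<open>[0, 1]\<close>.
\<close>

lemma powr_convex_ge_0:
  fixes u v x y P :: real
  assumes "1 \<le> P" "0 \<le> u" "0 \<le> v" "u + v = 1" "0 \<le> x" "0 \<le> y"
  shows "(u * x + v * y) powr P \<le> u * x powr P + v * y powr P"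
proof -
  have scale: "(c * z) powr P \<le> c * z powr P" if "0 \<le> c" "c \<le> 1" "0 \<le> z" for c z :: real
  proof -
    have "c powr P \<le> c"
      using that assms(1) powr_mono'[of 1 P c] by (cases "c = 0") auto
    then show ?thesis
      using that by (simp add: powr_mult mult_right_mono)
  qed
  show ?thesis
  proof (cases "x = 0 \<or> y = 0")
    case True
    then show ?thesis using scale[of u x] scale[of v y] assms by auto
  next
    case False
    then have "x \<in> {0<..}" "y \<in> {0<..}" using assms by auto
    moreover have "u = 1 - v" "v \<le> 1" using assms by auto
    ultimately show ?thesis
      using convex_onD[OF powr_convex[OF assms(1)], of v x y] assms(2,3) by simp
  qed
qed

lemma Lp_space_measurable [measurable_dest]:
  "f \<in> Lp_space p \<Longrightarrow> f \<in> borel_measurable unit_cube"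
  by (simp add: Lp_space_def)

text \<open>
  If the essential supremum of a nonnegative function is negative, then the measure is null and the
  supremum is \<open>-\<infinity>\<close>, which becomes the real number \<open>0\<close>; likewise \<open>\<infinity>\<close>, the value for nonmeasurable
  functions, becomes \<open>0\<close>.
\<close>

lemma real_of_ereal_esssup_nonneg:
  assumes "\<And>t. 0 \<le> g t"
  shows "0 \<le> real_of_ereal (esssup N g)"
proof (cases "g \<in> borel_measurable N")
  case True
  have "0 \<le> esssup N g" if "esssup N g \<noteq> -\<infinity>"
  proof (rule ccontr)
    assume neg: "\<not> 0 \<le> esssup N g"
    have "AE t in N. g t \<le> - \<infinity>"
      using esssup_AE[of g N] by eventually_elim (metis assms neg order_trans)
    then have "esssup N g \<le> -\<infinity>" using True by (intro esssup_I)
    with that show False by simp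
  qed
  then show ?thesis by (cases "esssup N g = -\<infinity>") (auto simp: real_of_ereal_pos)
next
  case False
  then show ?thesis by (simp add: esssup_non_measurable top_ereal_def)
qed

lemma Lp_norm_nonneg: "0 \<le> Lp_norm p f"
  by (simp add: Lp_norm_def real_of_ereal_esssup_nonneg)

text \<open>
  The next two characterisations of balls in \<open>L\<^sub>p\<close> are how norms are handled below: they turn the
  claims for \<open>p = \<infinity>\<close> into pointwise ones, and for \<open>p < \<infinity>\<close> they remove the outer root, so that
  pointwise convexity can be integrated. Membership is part of the equivalences because the real
  number \<open>Lp_norm p f\<close> carries no information outside of \<open>Lp_space p\<close>.
\<close>

lemma Lp_norm_infinity_le_iff:
  assumes "0 \<le> c"
  shows "f \<in> Lp_space \<infinity> \<and> Lp_norm \<infinity> f \<le> c \<longleftrightarrow>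
    f \<in> borel_measurable unit_cube \<and> (AE t in unit_cube. \<bar>f t\<bar> \<le> c)"
proof (cases "f \<in> borel_measurable unit_cube")
  case True
  note [measurable] = True
  let ?e = "esssup unit_cube (\<lambda>t. ereal \<bar>f t\<bar>)"
  have "?e < \<infinity> \<and> real_of_ereal ?e \<le> c \<longleftrightarrow> ?e \<le> ereal c"
    using assms by (cases ?e) auto
  also have "\<dots> \<longleftrightarrow> (AE t in unit_cube. ereal \<bar>f t\<bar> \<le> ereal c)"
  proof
    assume "?e \<le> ereal c"
    with esssup_AE[of "\<lambda>t. ereal \<bar>f t\<bar>" unit_cube]
    show "AE t in unit_cube. ereal \<bar>f t\<bar> \<le> ereal c"
      by (elim eventually_mono) (rule order_trans)
  qed (rule esssup_I, simp_all)
  finally show ?thesis using True by (simp add: Lp_space_def Lp_norm_def)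
qed (simp add: Lp_space_def)

lemma enn2real_ge_1: "1 \<le> enn2real p" if "1 \<le> p" "p \<noteq> \<infinity>" for p :: ennreal
  using that by (cases p) (auto simp: top_unique simp flip: ennreal_1)

lemma Lp_norm_finite_le_iff:
  assumes "1 \<le> p" "p \<noteq> \<infinity>" "0 < c"
  shows "f \<in> Lp_space p \<and> Lp_norm p f \<le> c \<longleftrightarrow>
    f \<in> borel_measurable unit_cube \<and>
    integrable unit_cube (\<lambda>t. \<bar>f t / c\<bar> powr enn2real p) \<and>
    (\<integral>t. \<bar>f t / c\<bar> powr enn2real p \<partial>unit_cube) \<le> 1"
proof -
  let ?P = "enn2real p"
  let ?I = "\<integral>t. \<bar>f t\<bar> powr ?P \<partial>unit_cube"
  have P: "1 \<le> ?P" using assms enn2real_ge_1 by blast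
  have cP: "0 < c powr ?P" using assms by simp
  have I: "0 \<le> ?I" by simp
  have eq: "(\<lambda>t. \<bar>f t / c\<bar> powr ?P) = (\<lambda>t. \<bar>f t\<bar> powr ?P / c powr ?P)"
    using assms by (simp add: powr_divide)
  have int: "integrable unit_cube (\<lambda>t. \<bar>f t\<bar> powr ?P / c powr ?P) \<longleftrightarrow>
      integrable unit_cube (\<lambda>t. \<bar>f t\<bar> powr ?P)"
    using cP integrable_mult_left_iff[of unit_cube "inverse (c powr ?P)" "\<lambda>t. \<bar>f t\<bar> powr ?P"]
    by (simp add: divide_inverse)
  have "?I powr (1 / ?P) \<le> c \<longleftrightarrow> ?I \<le> c powr ?P"
  proof
    assume "?I powr (1 / ?P) \<le> c"
    then have "(?I powr (1 / ?P)) powr ?P \<le> c powr ?P"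
      using P by (intro powr_mono2) auto
    then show "?I \<le> c powr ?P" using P I by (simp add: powr_powr)
  next
    assume "?I \<le> c powr ?P"
    then have "?I powr (1 / ?P) \<le> (c powr ?P) powr (1 / ?P)"
      using P I by (intro powr_mono2) auto
    then show "?I powr (1 / ?P) \<le> c" using P assms by (simp add: powr_powr)
  qed
  also have "\<dots> \<longleftrightarrow> ?I / c powr ?P \<le> 1" using cP by simp
  finally have norm: "?I powr (1 / ?P) \<le> c \<longleftrightarrow> ?I / c powr ?P \<le> 1" .
  show ?thesis
    unfolding eq int integral_divide_zero norm[symmetric]
    using assms by (simp add: Lp_space_def Lp_norm_def conj_assoc)
qed

text \<open>
  With strictly positive bounds in place of the norms, no division by a vanishing norm can occur.
  For \<open>p < \<infinity>\<close>, \<open>(f + g) / (a + b)\<close> is the convex combination of \<open>f / a\<close> and \<open>g / b\<close> with weights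
  \<open>a / (a + b)\<close> and \<open>b / (a + b)\<close>, and the unit ball is convex because \<open>x powr p\<close> is.
\<close>

lemma Lp_norm_add_le_bounds:
  assumes p: "1 \<le> p" and ab: "0 < a" "0 < b"
    and f: "f \<in> Lp_space p" "Lp_norm p f \<le> a"
    and g: "g \<in> Lp_space p" "Lp_norm p g \<le> b"
  shows "(\<lambda>t. f t + g t) \<in> Lp_space p \<and> Lp_norm p (\<lambda>t. f t + g t) \<le> a + b"
proof (cases "p = \<infinity>")
  case True
  have "AE t in unit_cube. \<bar>f t\<bar> \<le> a" "AE t in unit_cube. \<bar>g t\<bar> \<le> b"
    using Lp_norm_infinity_le_iff[of a f] Lp_norm_infinity_le_iff[of b g] f g ab True by auto
  then have "AE t in unit_cube. \<bar>f t + g t\<bar> \<le> a + b"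
    by eventually_elim linarith
  then show ?thesis
    using Lp_norm_infinity_le_iff[of "a + b" "\<lambda>t. f t + g t"] f g ab True
    by (auto dest: Lp_space_measurable)
next
  case False
  let ?P = "enn2real p"
  let ?u = "a / (a + b)" and ?v = "b / (a + b)"
  have [measurable]: "f \<in> borel_measurable unit_cube" "g \<in> borel_measurable unit_cube"
    using f g by (auto dest: Lp_space_measurable)
  have uv: "0 \<le> ?u" "0 \<le> ?v" "?u + ?v = 1" using ab by (auto simp flip: add_divide_distrib)
  have P: "1 \<le> ?P" using enn2real_ge_1 p False by blast
  have fi: "integrable unit_cube (\<lambda>t. \<bar>f t / a\<bar> powr ?P)"
    and f1: "(\<integral>t. \<bar>f t / a\<bar> powr ?P \<partial>unit_cube) \<le> 1"
    using Lp_norm_finite_le_iff[OF p False, of a f] f ab by auto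
  have gi: "integrable unit_cube (\<lambda>t. \<bar>g t / b\<bar> powr ?P)"
    and g1: "(\<integral>t. \<bar>g t / b\<bar> powr ?P \<partial>unit_cube) \<le> 1"
    using Lp_norm_finite_le_iff[OF p False, of b g] g ab by auto
  have bound: "\<bar>(f t + g t) / (a + b)\<bar> powr ?P
      \<le> ?u * \<bar>f t / a\<bar> powr ?P + ?v * \<bar>g t / b\<bar> powr ?P" for t
  proof -
    have "\<bar>(f t + g t) / (a + b)\<bar> = \<bar>?u * (f t / a) + ?v * (g t / b)\<bar>"
      using ab by (simp add: add_divide_distrib)
    also have "\<dots> \<le> ?u * \<bar>f t / a\<bar> + ?v * \<bar>g t / b\<bar>"
      using uv by (intro order_trans[OF abs_triangle_ineq]) (simp only: abs_mult abs_of_nonneg order_refl)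
    finally have "\<bar>(f t + g t) / (a + b)\<bar> powr ?P \<le> (?u * \<bar>f t / a\<bar> + ?v * \<bar>g t / b\<bar>) powr ?P"
      using P by (intro powr_mono2) auto
    also have "\<dots> \<le> ?u * \<bar>f t / a\<bar> powr ?P + ?v * \<bar>g t / b\<bar> powr ?P"
      using P uv by (intro powr_convex_ge_0) auto
    finally show ?thesis .
  qed
  have ri: "integrable unit_cube (\<lambda>t. ?u * \<bar>f t / a\<bar> powr ?P + ?v * \<bar>g t / b\<bar> powr ?P)"
    using fi gi by (intro Bochner_Integration.integrable_add integrable_mult_right)
  have hi: "integrable unit_cube (\<lambda>t. \<bar>(f t + g t) / (a + b)\<bar> powr ?P)"
    by (rule Bochner_Integration.integrable_bound[OF ri])
      (use bound in \<open>auto intro!: AE_I2 order_trans[OF _ abs_ge_self]\<close>)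
  have "(\<integral>t. \<bar>(f t + g t) / (a + b)\<bar> powr ?P \<partial>unit_cube)
      \<le> (\<integral>t. ?u * \<bar>f t / a\<bar> powr ?P + ?v * \<bar>g t / b\<bar> powr ?P \<partial>unit_cube)"
    by (intro integral_mono hi ri bound)
  also have "\<dots> = ?u * (\<integral>t. \<bar>f t / a\<bar> powr ?P \<partial>unit_cube) + ?v * (\<integral>t. \<bar>g t / b\<bar> powr ?P \<partial>unit_cube)"
    by (subst Bochner_Integration.integral_add) (use fi gi in \<open>auto simp only: integrable_mult_right integral_mult_right_zero\<close>)
  also have "\<dots> \<le> ?u * 1 + ?v * 1"
    by (intro add_mono mult_left_mono f1 g1 uv)
  finally show ?thesis
    using Lp_norm_finite_le_iff[OF p False, of "a + b" "\<lambda>t. f t + g t"] hi ab uv by simp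
qed

lemma ennreal_inverse_eq_1D:
  fixes x :: ennreal
  assumes "inverse x = 1"
  shows "x = 1"
proof (cases x)
  case (real r)
  then have "r \<noteq> 0" using assms by auto
  then have "ennreal (inverse r) = 1" using real assms by (simp add: inverse_ennreal)
  then have "inverse r = 1" by (simp only: ennreal_eq_1)
  then have "r = 1" by (metis inverse_1 inverse_inverse_eq)
  then show ?thesis using real by simp
qed (use assms in simp)

lemma conjugate_exponent_cases:
  fixes p q :: ennreal
  assumes "1 \<le> p" "inverse p + inverse q = 1"
  obtains "p = 1" "q = \<infinity>" | "p = \<infinity>" "q = 1"
  | "p \<noteq> \<infinity>" "q \<noteq> \<infinity>" "1 < enn2real p" "1 < enn2real q"
    "1 / enn2real p + 1 / enn2real q = 1"
proof (cases p)
  case (real P)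
  then have P: "1 \<le> P" using assms by (simp flip: ennreal_1)
  show ?thesis
  proof (cases q)
    case (real Q)
    have "Q > 0" 
    proof (rule ccontr)
      assume "\<not> 0 < Q"
      with real have "inverse q = \<infinity>" by simp
      with assms show False by simp
    qed
    have "inverse p + inverse q = ennreal (inverse P + inverse Q)"
      using P \<open>Q > 0\<close> real \<open>p = ennreal P\<close> by (simp add: inverse_ennreal ennreal_plus)
    with assms have "ennreal (inverse P + inverse Q) = 1" by simp
    then have e: "1 / P + 1 / Q = 1"
      by (simp only: ennreal_eq_1 inverse_eq_divide)
    have "1 / P < 1" "1 / Q < 1" using e P \<open>Q > 0\<close> zero_less_divide_1_iff by smt+
    then have "1 < P" "1 < Q" using P \<open>Q > 0\<close> by auto
    then show ?thesis using that(3) real \<open>p = ennreal P\<close> e by simp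
  next
    case top
    then have "inverse p = 1" using assms by simp
    then have "p = 1" by (rule ennreal_inverse_eq_1D) 
    then show ?thesis using top that(1) by simp
  qed
next
  case top
  then have "inverse q = 1" using assms by simp
  then have "q = 1" by (rule ennreal_inverse_eq_1D)
  then show ?thesis using top that(2) by simp
qed

lemma conjugate_exponent_ge_1:
  fixes p q :: ennreal
  assumes "1 \<le> p" "inverse p + inverse q = 1"
  shows "1 \<le> q"
  using assms
proof (cases rule: conjugate_exponent_cases)
  case 3
  then show ?thesis by (cases q) (auto simp flip: ennreal_1)
qed auto

text \<open>As for sums, the bounds \<open>a\<close> and \<open>b\<close> replace the norms in order to be positive.\<close>

lemma Holder_infinity_1:
  assumes ab: "0 < a" "0 < b"
    and f: "f \<in> Lp_space \<infinity>" "Lp_norm \<infinity> f \<le> a"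
    and g: "g \<in> Lp_space 1" "Lp_norm 1 g \<le> b"
  shows "integrable unit_cube (\<lambda>t. f t * g t) \<and> (\<integral>t. \<bar>f t * g t\<bar> \<partial>unit_cube) \<le> a * b"
proof -
  have [measurable]: "f \<in> borel_measurable unit_cube" "g \<in> borel_measurable unit_cube"
    using f g by (auto dest: Lp_space_measurable)
  have fa: "AE t in unit_cube. \<bar>f t\<bar> \<le> a"
    using Lp_norm_infinity_le_iff[of a f] f ab by auto
  have "integrable unit_cube (\<lambda>t. \<bar>g t / b\<bar> powr 1)"
    and g1: "(\<integral>t. \<bar>g t / b\<bar> powr 1 \<partial>unit_cube) \<le> 1"
    using Lp_norm_finite_le_iff[of 1 b g] g ab by auto
  then have gi: "integrable unit_cube (\<lambda>t. (a * b) * (\<bar>g t / b\<bar> powr 1))"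
    by (intro integrable_mult_right)
  have bd: "AE t in unit_cube. \<bar>f t * g t\<bar> \<le> (a * b) * (\<bar>g t / b\<bar> powr 1)"
    using fa by eventually_elim (use ab in \<open>auto simp: abs_mult intro: mult_right_mono\<close>)
  have i: "integrable unit_cube (\<lambda>t. f t * g t)"
  proof (rule Bochner_Integration.integrable_bound[OF gi])
    show "AE t in unit_cube. norm (f t * g t) \<le> norm ((a * b) * (\<bar>g t / b\<bar> powr 1))"
      using bd by eventually_elim (simp only: real_norm_def order_trans[OF _ abs_ge_self])
  qed simp
  have "(\<integral>t. \<bar>f t * g t\<bar> \<partial>unit_cube) \<le> (\<integral>t. (a * b) * (\<bar>g t / b\<bar> powr 1) \<partial>unit_cube)"
    using i by (intro integral_mono_AE gi bd) auto
  also have "\<dots> = (a * b) * (\<integral>t. \<bar>g t / b\<bar> powr 1 \<partial>unit_cube)" by (rule integral_mult_right_zero)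
  also have "\<dots> \<le> a * b" using mult_left_mono[OF g1, of "a * b"] ab by simp
  finally show ?thesis using i by simp
qed

text \<open>
  For exponents in the open range, integrating Young's inequality for \<open>\<bar>f\<bar> / a\<close> and \<open>\<bar>g\<bar> / b\<close> leaves
  \<open>1 / p + 1 / q = 1\<close>.
\<close>

lemma Holder_bounds:
  assumes p: "1 \<le> p" and pq: "inverse p + inverse q = 1" and ab: "0 < a" "0 < b"
    and f: "f \<in> Lp_space p" "Lp_norm p f \<le> a"
    and g: "g \<in> Lp_space q" "Lp_norm q g \<le> b"
  shows "integrable unit_cube (\<lambda>t. f t * g t) \<and> (\<integral>t. \<bar>f t * g t\<bar> \<partial>unit_cube) \<le> a * b"
  using p pq
proof (cases rule: conjugate_exponent_cases)
  case 1
  then show ?thesis using Holder_infinity_1[of b a g f] f g ab by (simp add: mult.commute)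
next
  case 2
  then show ?thesis using Holder_infinity_1[of a b f g] f g ab by simp
next
  case 3
  let ?P = "enn2real p" and ?Q = "enn2real q"
  have [measurable]: "f \<in> borel_measurable unit_cube" "g \<in> borel_measurable unit_cube"
    using f g by (auto dest: Lp_space_measurable)
  have q: "1 \<le> q" using conjugate_exponent_ge_1[OF p pq] .
  have fi: "integrable unit_cube (\<lambda>t. \<bar>f t / a\<bar> powr ?P)"
    and f1: "(\<integral>t. \<bar>f t / a\<bar> powr ?P \<partial>unit_cube) \<le> 1"
    using Lp_norm_finite_le_iff[OF p 3(1), of a f] f ab by auto
  have gi: "integrable unit_cube (\<lambda>t. \<bar>g t / b\<bar> powr ?Q)"
    and g1: "(\<integral>t. \<bar>g t / b\<bar> powr ?Q \<partial>unit_cube) \<le> 1"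
    using Lp_norm_finite_le_iff[OF q 3(2), of b g] g ab by auto
  let ?r = "\<lambda>t. \<bar>f t / a\<bar> powr ?P / ?P + \<bar>g t / b\<bar> powr ?Q / ?Q"
  have ri: "integrable unit_cube (\<lambda>t. (a * b) * ?r t)"
    using fi gi by (intro integrable_mult_right Bochner_Integration.integrable_add integrable_divide)
  have bd: "\<bar>f t * g t\<bar> \<le> (a * b) * ?r t" for t
  proof -
    have "\<bar>f t / a\<bar> * \<bar>g t / b\<bar> \<le> ?r t" by (rule Youngs_inequality) (use 3 in auto)
    then have "(a * b) * (\<bar>f t / a\<bar> * \<bar>g t / b\<bar>) \<le> (a * b) * ?r t"
      using ab by (intro mult_left_mono) auto
    then show ?thesis using ab by (simp add: abs_mult)
  qed
  have i: "integrable unit_cube (\<lambda>t. f t * g t)"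
    by (rule Bochner_Integration.integrable_bound[OF ri])
      (use bd in \<open>auto intro!: AE_I2 order_trans[OF _ abs_ge_self]\<close>)
  have "(\<integral>t. \<bar>f t * g t\<bar> \<partial>unit_cube) \<le> (\<integral>t. (a * b) * ?r t \<partial>unit_cube)"
    using i by (intro integral_mono ri bd) auto
  also have "\<dots> = (a * b) * ((\<integral>t. \<bar>f t / a\<bar> powr ?P \<partial>unit_cube) / ?P + (\<integral>t. \<bar>g t / b\<bar> powr ?Q \<partial>unit_cube) / ?Q)"
    by (subst integral_mult_right_zero, subst Bochner_Integration.integral_add)
      (use fi gi in \<open>auto simp only: integrable_divide integral_divide_zero\<close>)
  also have "\<dots> \<le> (a * b) * (1 / ?P + 1 / ?Q)"
    using ab 3 by (intro mult_left_mono add_mono divide_right_mono f1 g1) auto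
  finally show ?thesis using i 3 by simp
qed

lemma Holder_inequality:
  assumes p: "1 \<le> p" and pq: "inverse p + inverse q = 1"
    and f: "f \<in> Lp_space p" and g: "g \<in> Lp_space q"
  shows "integrable unit_cube (\<lambda>t. f t * g t)"
    and "\<bar>pairing f g\<bar> \<le> Lp_norm p f * Lp_norm q g"
proof -
  have bd: "integrable unit_cube (\<lambda>t. f t * g t) \<and>
      (\<integral>t. \<bar>f t * g t\<bar> \<partial>unit_cube) \<le> (Lp_norm p f + e) * (Lp_norm q g + e)" if "0 < e" for e
    by (rule Holder_bounds[OF p pq _ _ f _ g])
      (use that Lp_norm_nonneg[of p f] Lp_norm_nonneg[of q g] in auto)
  show "integrable unit_cube (\<lambda>t. f t * g t)" using bd[of 1] by simp
  \<comment> \<open>The positive bounds \<open>norm + e\<close> decrease to the norms.\<close>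
  have "((\<lambda>e. (Lp_norm p f + e) * (Lp_norm q g + e)) \<longlongrightarrow> (Lp_norm p f + 0) * (Lp_norm q g + 0))
      (at_right 0)"
    by (intro tendsto_intros)
  then have "(\<integral>t. \<bar>f t * g t\<bar> \<partial>unit_cube) \<le> (Lp_norm p f + 0) * (Lp_norm q g + 0)"
    by (rule tendsto_lowerbound) (use bd in \<open>auto simp: eventually_at_filter\<close>)
  moreover have "\<bar>pairing f g\<bar> \<le> (\<integral>t. \<bar>f t * g t\<bar> \<partial>unit_cube)"
    unfolding pairing_def by (rule integral_abs_bound)
  ultimately show "\<bar>pairing f g\<bar> \<le> Lp_norm p f * Lp_norm q g" by simp
qed

lemma Lp_space_add:
  assumes "1 \<le> p" "f \<in> Lp_space p" "g \<in> Lp_space p"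
  shows "(\<lambda>t. f t + g t) \<in> Lp_space p"
  using Lp_norm_add_le_bounds[OF assms(1) _ _ assms(2) _ assms(3),
      of "Lp_norm p f + 1" "Lp_norm p g + 1"] Lp_norm_nonneg[of p f] Lp_norm_nonneg[of p g]
  by simp

lemma Minkowski_inequality:
  assumes "1 \<le> p" "f \<in> Lp_space p" "g \<in> Lp_space p"
  shows "Lp_norm p (\<lambda>t. f t + g t) \<le> Lp_norm p f + Lp_norm p g"
proof (rule field_le_epsilon)
  fix e :: real assume "0 < e"
  then show "Lp_norm p (\<lambda>t. f t + g t) \<le> Lp_norm p f + Lp_norm p g + e"
    using Lp_norm_add_le_bounds[OF assms(1) _ _ assms(2) _ assms(3),
      of "Lp_norm p f + e / 2" "Lp_norm p g + e / 2"] Lp_norm_nonneg[of p f] Lp_norm_nonneg[of p g]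
    by simp
qed

text \<open>
  Two net points whose aggregates agree almost everywhere have no probe function; this lemma serves
  that case, and the empty sum and the scaling by \<open>0\<close> below.
\<close>

lemma Lp_norm_AE_zero:
  fixes f :: "real^'d::finite \<Rightarrow> real"
  assumes "1 \<le> p" "f \<in> borel_measurable unit_cube" "AE t in unit_cube. f t = 0"
  shows "f \<in> Lp_space p" and "Lp_norm p f = 0"
proof -
  have bd: "f \<in> Lp_space p \<and> Lp_norm p f \<le> c" if "0 < c" for c
  proof (cases "p = \<infinity>")
    case True
    have "AE t in unit_cube. \<bar>f t\<bar> \<le> c" using assms(3) by eventually_elim (use that in auto)
    then show ?thesis using True Lp_norm_infinity_le_iff[of c f] assms that by auto
  next
    case False
    have z: "AE t in unit_cube. \<bar>f t / c\<bar> powr enn2real p = 0"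
      using assms(3) by eventually_elim auto
    have [measurable]: "f \<in> borel_measurable unit_cube" by fact
    have "integrable unit_cube (\<lambda>t. \<bar>f t / c\<bar> powr enn2real p) \<longleftrightarrow>
        integrable unit_cube (\<lambda>t :: real^'d. 0 :: real)"
      by (rule integrable_cong_AE) (use assms(3) in simp_all)
    moreover have "(\<integral>t. \<bar>f t / c\<bar> powr enn2real p \<partial>unit_cube) = 0"
      using integral_eq_zero_AE[OF z] .
    ultimately show ?thesis
      using Lp_norm_finite_le_iff[OF assms(1) False that, of f] assms by simp
  qed
  show "f \<in> Lp_space p" using bd[of 1] by simp
  have "Lp_norm p f \<le> 0" by (rule field_le_epsilon) (use bd in auto)
  then show "Lp_norm p f = 0" using Lp_norm_nonneg[of p f] by simp
qed

lemma Lp_scale: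
  fixes f :: "real^'d::finite \<Rightarrow> real"
  assumes "1 \<le> p" "f \<in> Lp_space p"
  shows "(\<lambda>t. c * f t) \<in> Lp_space p" and "Lp_norm p (\<lambda>t. c * f t) \<le> \<bar>c\<bar> * Lp_norm p f"
proof -
  have m [measurable]: "f \<in> borel_measurable unit_cube" using assms by (auto dest: Lp_space_measurable)
  have "(\<lambda>t. c * f t) \<in> Lp_space p \<and> Lp_norm p (\<lambda>t. c * f t) \<le> \<bar>c\<bar> * Lp_norm p f"
  proof (cases "c = 0")
    case True
    then show ?thesis using Lp_norm_AE_zero[OF assms(1), of "\<lambda>t :: real^'d. 0"] by simp
  next
    case c: False
    have bd: "(\<lambda>t. c * f t) \<in> Lp_space p \<and> Lp_norm p (\<lambda>t. c * f t) \<le> \<bar>c\<bar> * (Lp_norm p f + e)"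
      if "0 < e" for e
    proof -
      let ?a = "Lp_norm p f + e"
      have a: "0 < ?a" using that Lp_norm_nonneg[of p f] by simp
      show ?thesis
      proof (cases "p = \<infinity>")
        case True
        have "AE t in unit_cube. \<bar>f t\<bar> \<le> ?a"
          using True Lp_norm_infinity_le_iff[of ?a f] assms that a by simp
        then have "AE t in unit_cube. \<bar>c * f t\<bar> \<le> \<bar>c\<bar> * ?a"
          by eventually_elim (simp add: abs_mult mult_left_mono)
        then show ?thesis
          using True Lp_norm_infinity_le_iff[of "\<bar>c\<bar> * ?a" "\<lambda>t. c * f t"] a by simp
      next
        case False
        have "(\<lambda>t. \<bar>c * f t / (\<bar>c\<bar> * ?a)\<bar> powr enn2real p) = (\<lambda>t. \<bar>f t / ?a\<bar> powr enn2real p)"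
          using c by (auto simp: abs_mult)
        then show ?thesis
          using Lp_norm_finite_le_iff[OF assms(1) False, of ?a f]
            Lp_norm_finite_le_iff[OF assms(1) False, of "\<bar>c\<bar> * ?a" "\<lambda>t. c * f t"] a c assms that
          by simp
      qed
    qed
    have "Lp_norm p (\<lambda>t. c * f t) \<le> \<bar>c\<bar> * Lp_norm p f"
    proof (rule field_le_epsilon)
      fix d :: real assume "0 < d"
      then show "Lp_norm p (\<lambda>t. c * f t) \<le> \<bar>c\<bar> * Lp_norm p f + d"
        using bd[of "d / \<bar>c\<bar>"] c by (simp add: distrib_left)
    qed
    then show ?thesis using bd[of 1] by simp
  qed
  then show "(\<lambda>t. c * f t) \<in> Lp_space p" "Lp_norm p (\<lambda>t. c * f t) \<le> \<bar>c\<bar> * Lp_norm p f"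
    by auto
qed

lemma Lp_norm_eq_0_imp_AE:
  assumes "1 \<le> p" "f \<in> Lp_space p" "Lp_norm p f = 0"
  shows "AE t in unit_cube. f t = 0"
proof (cases "p = \<infinity>")
  case True
  then have "AE t in unit_cube. \<bar>f t\<bar> \<le> 0" using Lp_norm_infinity_le_iff[of 0 f] assms by simp
  then show ?thesis by simp
next
  case False
  then have i: "integrable unit_cube (\<lambda>t. \<bar>f t\<bar> powr enn2real p)"
    using assms by (simp add: Lp_space_def)
  have "(\<integral>t. \<bar>f t\<bar> powr enn2real p \<partial>unit_cube) = 0"
    using assms False by (simp add: Lp_norm_def)
  then show ?thesis using integral_nonneg_eq_0_iff_AE[OF i] by simp
qed

lemma Lp_diff:
  assumes "1 \<le> p" "f \<in> Lp_space p" "g \<in> Lp_space p"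
  shows "(\<lambda>t. f t - g t) \<in> Lp_space p"
    and "Lp_norm p (\<lambda>t. f t - g t) \<le> Lp_norm p f + Lp_norm p g"
  using Lp_space_add[OF assms(1,2) Lp_scale(1)[OF assms(1,3), of "-1"]]
    Minkowski_inequality[OF assms(1,2) Lp_scale(1)[OF assms(1,3), of "-1"]]
    Lp_scale(2)[OF assms(1,3), of "-1"] by auto

lemma Lp_norm_minus_commute:
  assumes "1 \<le> p" "f \<in> Lp_space p" "g \<in> Lp_space p"
  shows "Lp_norm p (\<lambda>t. f t - g t) = Lp_norm p (\<lambda>t. g t - f t)"
  using Lp_scale(2)[OF assms(1) Lp_diff(1)[OF assms], of "-1"]
    Lp_scale(2)[OF assms(1) Lp_diff(1)[OF assms(1,3,2)], of "-1"]
  by simp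

lemma Lp_dist_triangle:
  assumes "1 \<le> p" "f \<in> Lp_space p" "g \<in> Lp_space p" "h \<in> Lp_space p"
  shows "Lp_norm p (\<lambda>t. f t - h t) \<le> Lp_norm p (\<lambda>t. f t - g t) + Lp_norm p (\<lambda>t. g t - h t)"
  using Minkowski_inequality[OF assms(1) Lp_diff(1)[OF assms(1,2,3)] Lp_diff(1)[OF assms(1,3,4)]]
  by simp

lemma Lp_sum:
  fixes h :: "'i \<Rightarrow> real^'d::finite \<Rightarrow> real"
  assumes "1 \<le> p" "finite I" "\<And>i. i \<in> I \<Longrightarrow> h i \<in> Lp_space p"
  shows "(\<lambda>t. \<Sum>i\<in>I. c i * h i t) \<in> Lp_space p \<and>
    Lp_norm p (\<lambda>t. \<Sum>i\<in>I. c i * h i t) \<le> (\<Sum>i\<in>I. \<bar>c i\<bar> * Lp_norm p (h i))"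
  using assms(2,3)
proof (induction I)
  case empty
  then show ?case using Lp_norm_AE_zero[OF assms(1), of "\<lambda>t :: real^'d. 0"] by simp
next
  case (insert i I)
  then have *: "(\<lambda>t. c i * h i t) \<in> Lp_space p" "(\<lambda>t. \<Sum>i\<in>I. c i * h i t) \<in> Lp_space p"
    using Lp_scale[OF assms(1)] by auto
  show ?case
    using Lp_space_add[OF assms(1) *] Minkowski_inequality[OF assms(1) *]
      Lp_scale(2)[OF assms(1), of "h i" "c i"] insert by auto
qed

section \<open>Pairings and convex aggregates\<close>

lemma pairing_bound:
  assumes "1 \<le> p" "inverse p + inverse q = 1" "\<psi> \<in> Lp_space q" "g \<in> Lp_space p"
  shows "\<bar>pairing \<psi> g\<bar> \<le> Lp_norm q \<psi> * Lp_norm p g"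
  using Holder_inequality(2)[OF assms(1,2,4,3)] by (simp add: pairing_def mult.commute)

lemma pairing_diff:
  assumes "1 \<le> p" "inverse p + inverse q = 1" "\<psi> \<in> Lp_space q" "g \<in> Lp_space p" "h \<in> Lp_space p"
  shows "pairing \<psi> (\<lambda>t. g t - h t) = pairing \<psi> g - pairing \<psi> h"
  using Holder_inequality(1)[OF assms(1,2,4,3)] Holder_inequality(1)[OF assms(1,2,5,3)]
  by (simp add: pairing_def right_diff_distrib mult.commute)

text \<open>
  The weights enter the norm only through their \<open>l\<^sub>1\<close>-distance: \<open>l \<mapsto> aggregate fs l\<close> is Lipschitz
  with constant \<open>L\<close> from \<open>l\<^sub>1\<close> to \<open>L\<^sub>p\<close>. This is why an \<open>l\<^sub>1\<close>-net of weights suffices, why the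
  approximation error is continuous in the weights, and why aggregates stay in the ball of radius \<open>L\<close>.
\<close>

context
  fixes p :: ennreal and fs :: "'n::finite \<Rightarrow> real^'d::finite \<Rightarrow> real" and L :: real
  assumes p: "1 \<le> p" and fs: "\<And>i. fs i \<in> Lp_space p" and L: "\<And>i. Lp_norm p (fs i) \<le> L"
begin

lemma aggregate_in_Lp_space: "aggregate fs l \<in> Lp_space p"
  using Lp_sum[OF p, of UNIV fs "\<lambda>i. l $ i"] fs by (simp add: aggregate_def[abs_def])

lemma aggregate_diff_norm_le:
  "Lp_norm p (\<lambda>t. aggregate fs l t - aggregate fs m t) \<le> (\<Sum>i\<in>UNIV. \<bar>l $ i - m $ i\<bar>) * L"
proof -
  have "Lp_norm p (\<lambda>t. \<Sum>i\<in>UNIV. (l $ i - m $ i) * fs i t)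
      \<le> (\<Sum>i\<in>UNIV. \<bar>l $ i - m $ i\<bar> * Lp_norm p (fs i))"
    using Lp_sum[OF p, of UNIV fs "\<lambda>i. l $ i - m $ i"] fs by simp
  also have "\<dots> \<le> (\<Sum>i\<in>UNIV. \<bar>l $ i - m $ i\<bar> * L)"
    by (intro sum_mono mult_left_mono L) auto
  finally show ?thesis
    by (simp add: aggregate_def left_diff_distrib sum_subtractf sum_distrib_right)
qed

lemma aggregate_norm_le:
  assumes "l \<in> weights"
  shows "Lp_norm p (aggregate fs l) \<le> L"
proof -
  have "0 \<le> L" using L Lp_norm_nonneg order_trans by blast
  have "Lp_norm p (aggregate fs l) \<le> (\<Sum>i\<in>UNIV. \<bar>l $ i\<bar>) * L"
    using aggregate_diff_norm_le[of l 0] by (simp add: aggregate_def[abs_def])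
  also have "\<dots> \<le> 1 * L"
    using assms \<open>0 \<le> L\<close> by (intro mult_right_mono) (auto simp: weights_def)
  finally show ?thesis by simp
qed

lemma continuous_on_aggregation_error:
  assumes f: "f \<in> Lp_space p"
  shows "continuous_on S (\<lambda>l. Lp_norm p (\<lambda>t. f t - aggregate fs l t))"
proof (rule continuous_at_imp_continuous_on, rule ballI)
  fix l :: "real^'n"
  let ?N = "\<lambda>l. Lp_norm p (\<lambda>t. f t - aggregate fs l t)"
  have bd: "\<bar>?N m - ?N l\<bar> \<le> (\<Sum>i\<in>UNIV. \<bar>m $ i - l $ i\<bar>) * L" for m
  proof -
    note [simp] = aggregate_in_Lp_space
    have "?N m \<le> ?N l + Lp_norm p (\<lambda>t. aggregate fs l t - aggregate fs m t)"
      "?N l \<le> ?N m + Lp_norm p (\<lambda>t. aggregate fs m t - aggregate fs l t)"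
      by (intro Lp_dist_triangle p f; simp)+
    then show ?thesis
      using aggregate_diff_norm_le[of m l] aggregate_diff_norm_le[of l m]
      by (simp add: abs_minus_commute)
  qed
  have "((\<lambda>m. (\<Sum>i\<in>UNIV. \<bar>m $ i - l $ i\<bar>) * L) \<longlongrightarrow> (\<Sum>i\<in>UNIV. \<bar>l $ i - l $ i\<bar>) * L) (at l)"
    by (intro tendsto_intros)
  then have "((\<lambda>m. (\<Sum>i\<in>UNIV. \<bar>m $ i - l $ i\<bar>) * L) \<longlongrightarrow> 0) (at l)" by simp
  then have "((\<lambda>m. ?N m - ?N l) \<longlongrightarrow> 0) (at l)"
    by (rule Lim_null_comparison[rotated]) (use bd in auto)
  then show "isCont ?N l" unfolding isCont_def by (simp add: LIM_zero_iff)
qed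

end

lemma compact_weights: "compact (weights :: (real^'n::finite) set)"
proof -
  have "(weights :: (real^'n) set) = (\<Inter>i. {l. 0 \<le> l $ i}) \<inter> {l. (\<Sum>i\<in>UNIV. l $ i) \<le> 1}"
    by (auto simp: weights_def)
  moreover have "closed {l :: real^'n. 0 \<le> l $ i}" for i
    by (intro closed_Collect_le continuous_intros)
  moreover have "closed {l :: real^'n. (\<Sum>i\<in>UNIV. l $ i) \<le> 1}"
    by (intro closed_Collect_le continuous_intros)
  ultimately have "closed (weights :: (real^'n) set)" by (metis closed_INT closed_Int)
  moreover have "bounded (weights :: (real^'n) set)"
  proof (rule boundedI)
    fix l :: "real^'n" assume "l \<in> weights"
    then show "norm l \<le> 1"
      using norm_le_l1_cart[of l] by (simp add: weights_def)
  qed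
  ultimately show ?thesis by (simp add: compact_eq_bounded_closed)
qed

text \<open>
  The approximation error is a continuous function on a compact set, so its infimum is attained and
  \<open>LEAST\<close> denotes a minimum.
\<close>

lemma best_aggregate_exists:
  fixes fs :: "'n::finite \<Rightarrow> real^'d::finite \<Rightarrow> real"
  assumes "1 \<le> p" "\<And>i. fs i \<in> Lp_space p" "f \<in> Lp_space p"
  obtains l where "l \<in> weights"
    "Lp_norm p (\<lambda>t. f t - aggregate fs l t) =
      (LEAST r. r \<in> (\<lambda>l. Lp_norm p (\<lambda>t. f t - aggregate fs l t)) ` weights)"
proof -
  let ?N = "\<lambda>l. Lp_norm p (\<lambda>t. f t - aggregate fs l t)"
  have "Lp_norm p (fs i) \<le> Max (range (\<lambda>i. Lp_norm p (fs i)))" for i by simp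
  note cont = continuous_on_aggregation_error[of p fs, OF assms(1,2) this assms(3), of weights]
  have "(0 :: real^'n) \<in> weights" by (simp add: weights_def)
  then obtain l where l: "l \<in> weights" "\<And>m. m \<in> weights \<Longrightarrow> ?N l \<le> ?N m"
    using continuous_attains_inf[OF compact_weights _ cont] by blast
  then have "(LEAST r. r \<in> ?N ` weights) = ?N l"
    by (intro Least_equality) auto
  with l(1) show ?thesis using that by simp
qed

section \<open>The critical value of the noise\<close>

text \<open>
  The law of \<open>Z \<psi>\<close> is Gaussian with mean \<open>0\<close> and variance \<open>\<integral> \<psi>\<^sup>2\<close>. The degenerate alternative in the
  definition of a Gaussian variable forces variance \<open>0\<close>, hence \<open>\<psi> = 0\<close> almost everywhere.
\<close>

lemma white_noise_no_atoms:
  assumes "white_noise M Z" and \<psi>: "\<psi> \<in> Lp_space 2" "\<not> (AE t in unit_cube. \<psi> t = 0)"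
  shows "Z \<psi> \<in> borel_measurable M" and "measure M {\<omega> \<in> space M. Z \<psi> \<omega> = c} = 0"
proof -
  interpret prob_space M using assms by (simp add: white_noise_def)
  have "gaussian_process M (Lp_space 2) Z" using assms(1) by (simp add: white_noise_def)
  from this[unfolded gaussian_process_def, rule_format, of "{\<psi>}" "\<lambda>_. 1"]
  have g: "gaussian_rv M (Z \<psi>)" using \<psi>(1) by simp
  then show m [measurable]: "Z \<psi> \<in> borel_measurable M" by (simp add: gaussian_rv_def)
  have mean: "(\<integral>\<omega>. Z \<psi> \<omega> \<partial>M) = 0" and var: "(\<integral>\<omega>. Z \<psi> \<omega> * Z \<psi> \<omega> \<partial>M) = pairing \<psi> \<psi>"
    using assms(1) \<psi>(1) by (auto simp: white_noise_def)
  have "\<not> (AE \<omega> in M. Z \<psi> \<omega> = \<mu>)" for \<mu>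
  proof
    assume const: "AE \<omega> in M. Z \<psi> \<omega> = \<mu>"
    have "(\<integral>\<omega>. Z \<psi> \<omega> \<partial>M) = (\<integral>\<omega>. \<mu> \<partial>M)"
      by (rule integral_cong_AE) (use const in auto)
    then have "\<mu> = 0" using mean by (simp add: prob_space)
    have "AE \<omega> in M. Z \<psi> \<omega> * Z \<psi> \<omega> = 0"
      using const by eventually_elim (simp add: \<open>\<mu> = 0\<close>)
    then have "pairing \<psi> \<psi> = 0" using var integral_eq_zero_AE[of "\<lambda>\<omega>. Z \<psi> \<omega> * Z \<psi> \<omega>" M] by simp
    moreover have "integrable unit_cube (\<lambda>t. \<psi> t * \<psi> t)"
      using \<psi>(1) by (simp add: Lp_space_def powr_numeral power2_eq_square)
    ultimately have "AE t in unit_cube. \<psi> t * \<psi> t = 0"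
      by (subst (asm) pairing_def, subst (asm) integral_nonneg_eq_0_iff_AE) auto
    with \<psi>(2) show False by simp
  qed
  then obtain \<mu> \<sigma> where d: "distributed M lborel (Z \<psi>) (\<lambda>x. ennreal (normal_density \<mu> \<sigma> x))"
    using g by (auto simp: gaussian_rv_def)
  have "emeasure M (Z \<psi> -` {c} \<inter> space M)
      = (\<integral>\<^sup>+x. ennreal (normal_density \<mu> \<sigma> x) * indicator {c} x \<partial>lborel)"
    by (rule distributed_emeasure[OF d]) simp
  also have "\<dots> = (\<integral>\<^sup>+x. 0 \<partial>(lborel :: real measure))"
  proof (rule nn_integral_cong_AE)
    show "AE x in lborel. ennreal (normal_density \<mu> \<sigma> x) * indicator {c} x = 0"
      using AE_lborel_singleton[of c] by eventually_elim simp
  qed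
  finally have "emeasure M (Z \<psi> -` {c} \<inter> space M) = 0" by simp
  moreover have "Z \<psi> -` {c} \<inter> space M = {\<omega> \<in> space M. Z \<psi> \<omega> = c}" by auto
  ultimately show "measure M {\<omega> \<in> space M. Z \<psi> \<omega> = c} = 0" by (simp add: measure_def)
qed

text \<open>
  Without atoms, the distribution function is continuous and the tail \<open>P (k \<le> X)\<close> is its complement,
  so the levels \<open>k \<ge> 0\<close> of tail probability at most \<open>\<delta>\<close> form a closed set. It contains its infimum,
  and it does not contain \<open>0\<close>, where the tail is \<open>1 > \<delta>\<close>. An atom at \<open>0\<close> could put the infimum
  at the excluded level \<open>0\<close>, and an atom elsewhere could make the tail jump at the infimum.
\<close>

lemma (in prob_space) quantile_attained:
  fixes X :: "'a \<Rightarrow> real"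
  assumes [measurable]: "X \<in> borel_measurable M"
    and nonneg: "\<And>\<omega>. \<omega> \<in> space M \<Longrightarrow> 0 \<le> X \<omega>"
    and no_atoms: "\<And>c. prob {\<omega> \<in> space M. X \<omega> = c} = 0"
    and \<delta>: "0 < \<delta>" "\<delta> < 1"
  defines "k \<equiv> (LEAST k. 0 < k \<and> prob {\<omega> \<in> space M. k \<le> X \<omega>} \<le> \<delta>)"
  shows "0 < k" and "prob {\<omega> \<in> space M. k \<le> X \<omega>} \<le> \<delta>"
proof -
  let ?D = "distr M borel X"
  interpret D: real_distribution ?D by (rule real_distribution_distr) measurable
  have cdf: "cdf ?D x = prob {\<omega> \<in> space M. X \<omega> \<le> x}" for x
    unfolding cdf_def by (subst measure_distr) (auto intro!: arg_cong[where f=prob])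
  have "measure ?D {x} = 0" for x
    using no_atoms[of x] by (subst measure_distr) (auto simp: vimage_def Int_def conj_commute)
  then have cont: "isCont (cdf ?D) x" for x by (simp add: D.isCont_cdf)
  have tail: "prob {\<omega> \<in> space M. x \<le> X \<omega>} = 1 - cdf ?D x" for x
  proof -
    have "prob {\<omega> \<in> space M. X \<omega> \<le> x}
        = prob ({\<omega> \<in> space M. X \<omega> < x} \<union> {\<omega> \<in> space M. X \<omega> = x})"
      by (intro arg_cong[where f=prob]) auto
    also have "\<dots> = prob {\<omega> \<in> space M. X \<omega> < x} + prob {\<omega> \<in> space M. X \<omega> = x}"
      by (intro finite_measure_Union) auto
    also have "\<dots> = prob {\<omega> \<in> space M. \<not> x \<le> X \<omega>}" by (simp add: no_atoms not_le)
    also have "\<dots> = 1 - prob {\<omega> \<in> space M. x \<le> X \<omega>}" by (rule prob_neg) measurable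
    finally show ?thesis by (simp add: cdf)
  qed
  have cdf_0: "cdf ?D 0 = 0"
  proof -
    have "{\<omega> \<in> space M. X \<omega> \<le> 0} = {\<omega> \<in> space M. X \<omega> = 0}"
      using nonneg by (auto intro: antisym)
    then show ?thesis by (simp add: cdf no_atoms)
  qed
  define S where "S = {x. 0 \<le> x \<and> 1 - \<delta> \<le> cdf ?D x}"
  have S: "0 < x \<and> prob {\<omega> \<in> space M. x \<le> X \<omega>} \<le> \<delta> \<longleftrightarrow> x \<in> S" for x
    using cdf_0 \<delta> by (cases "x = 0") (auto simp: S_def tail)
  have "closed S"
    unfolding S_def using cont
    by (intro closed_Collect_conj closed_Collect_le continuous_on_const continuous_on_id
        continuous_at_imp_continuous_on) auto
  moreover have "S \<noteq> {}"
  proof -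
    have "eventually (\<lambda>x. 1 - \<delta> < cdf ?D x) at_top"
      using D.cdf_lim_at_top_prob by (rule order_tendstoD(1)) (use \<delta> in auto)
    then have "eventually (\<lambda>x. 1 - \<delta> < cdf ?D x \<and> 0 \<le> x) at_top"
      by (intro eventually_conj eventually_ge_at_top)
    then obtain x where "1 - \<delta> < cdf ?D x \<and> 0 \<le> x"
      using eventually_happens'[OF trivial_limit_at_top_linorder] by blast
    then show ?thesis by (auto simp: S_def)
  qed
  moreover have "bdd_below S" by (auto simp: S_def)
  ultimately have "Inf S \<in> S" "\<And>x. x \<in> S \<Longrightarrow> Inf S \<le> x"
    by (auto intro: closed_contains_Inf cInf_lower)
  then have "(LEAST x. x \<in> S) \<in> S" by (rule LeastI2_order) auto
  then have "k \<in> S" unfolding k_def S .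
  then show "0 < k" "prob {\<omega> \<in> space M. k \<le> X \<omega>} \<le> \<delta>" using S by auto
qed

lemma max_noise_measurable:
  assumes "white_noise M Z" "finite \<Psi>" "\<Psi> \<subseteq> Lp_space 2"
    and "\<And>\<psi>. \<psi> \<in> \<Psi> \<Longrightarrow> \<not> (AE t in unit_cube. \<psi> t = 0)"
  shows "(\<lambda>\<omega>. MAX \<psi>\<in>\<Psi>. \<bar>Z \<psi> \<omega>\<bar> / Lp_norm 2 \<psi>) \<in> borel_measurable M"
  using assms white_noise_no_atoms(1)[OF assms(1)]
  by (intro borel_measurable_Max borel_measurable_divide borel_measurable_abs) auto

text \<open>
  The maximum over \<open>\<Psi>\<close> equals \<open>c\<close> only if some \<open>Z \<psi>\<close> equals \<open>c\<close> or \<open>-c\<close> times the norm of \<open>\<psi>\<close>,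
  so it has no atoms either.
\<close>

lemma critical_value_controls_noise:
  assumes wn: "white_noise M Z" and \<Psi>: "finite \<Psi>" "\<Psi> \<noteq> {}" "\<Psi> \<subseteq> Lp_space 2"
    and nonzero: "\<And>\<psi>. \<psi> \<in> \<Psi> \<Longrightarrow> \<not> (AE t in unit_cube. \<psi> t = 0)"
    and \<delta>: "0 < \<delta>" "\<delta> < 1"
  shows "0 < critical_value M Z \<Psi> \<delta>"
    and "measure M {\<omega> \<in> space M. critical_value M Z \<Psi> \<delta> \<le> (MAX \<psi>\<in>\<Psi>. \<bar>Z \<psi> \<omega>\<bar> / Lp_norm 2 \<psi>)} \<le> \<delta>"
proof -
  interpret prob_space M using wn by (simp add: white_noise_def)
  let ?X = "\<lambda>\<omega>. MAX \<psi>\<in>\<Psi>. \<bar>Z \<psi> \<omega>\<bar> / Lp_norm 2 \<psi>"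
  have Zm: "Z \<psi> \<in> borel_measurable M" if "\<psi> \<in> \<Psi>" for \<psi>
    using white_noise_no_atoms(1)[OF wn, of \<psi>] \<Psi>(3) nonzero that by auto
  have X [measurable]: "?X \<in> borel_measurable M"
    using wn \<Psi>(1,3) nonzero by (rule max_noise_measurable)
  have pos: "0 < Lp_norm 2 \<psi>" if "\<psi> \<in> \<Psi>" for \<psi>
    using Lp_norm_eq_0_imp_AE[of 2 \<psi>] Lp_norm_nonneg[of 2 \<psi>] nonzero[OF that] \<Psi>(3) that
    by (metis less_eq_real_def one_le_numeral subsetD)
  have nonneg: "0 \<le> ?X \<omega>" for \<omega>
    using \<Psi>(1,2) pos by (subst Max_ge_iff) (auto intro!: divide_nonneg_nonneg Lp_norm_nonneg)
  have no_atoms: "prob {\<omega> \<in> space M. ?X \<omega> = c} = 0" for c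
  proof -
    let ?A = "\<lambda>\<psi> s. {\<omega> \<in> space M. Z \<psi> \<omega> = s}"
    have A: "?A \<psi> s \<in> null_sets M" if "\<psi> \<in> \<Psi>" for \<psi> s
    proof -
      have [measurable]: "Z \<psi> \<in> borel_measurable M" using Zm that .
      show ?thesis
        using white_noise_no_atoms(2)[OF wn, of \<psi> s] \<Psi>(3) nonzero that
        by (auto simp: null_sets_def emeasure_eq_measure)
    qed
    have "{\<omega> \<in> space M. ?X \<omega> = c}
        \<subseteq> (\<Union>\<psi>\<in>\<Psi>. ?A \<psi> (c * Lp_norm 2 \<psi>) \<union> ?A \<psi> (- c * Lp_norm 2 \<psi>))"
    proof
      fix \<omega> assume \<omega>: "\<omega> \<in> {\<omega> \<in> space M. ?X \<omega> = c}"
      have "?X \<omega> \<in> (\<lambda>\<psi>. \<bar>Z \<psi> \<omega>\<bar> / Lp_norm 2 \<psi>) ` \<Psi>" using \<Psi>(1,2) by (intro Max_in) auto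
      then obtain \<psi> where \<psi>: "\<psi> \<in> \<Psi>" "c = \<bar>Z \<psi> \<omega>\<bar> / Lp_norm 2 \<psi>" using \<omega> by auto
      then have "\<bar>Z \<psi> \<omega>\<bar> = c * Lp_norm 2 \<psi>" using pos[OF \<psi>(1)] by simp
      then have "Z \<psi> \<omega> = c * Lp_norm 2 \<psi> \<or> Z \<psi> \<omega> = - c * Lp_norm 2 \<psi>" by linarith
      then show "\<omega> \<in> (\<Union>\<psi>\<in>\<Psi>. ?A \<psi> (c * Lp_norm 2 \<psi>) \<union> ?A \<psi> (- c * Lp_norm 2 \<psi>))"
        using \<omega> \<psi>(1) by blast
    qed
    moreover have "(\<Union>\<psi>\<in>\<Psi>. ?A \<psi> (c * Lp_norm 2 \<psi>) \<union> ?A \<psi> (- c * Lp_norm 2 \<psi>)) \<in> null_sets M"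
      using A \<Psi>(1) by (intro null_sets.finite_UN null_sets.Un) auto
    ultimately have "{\<omega> \<in> space M. ?X \<omega> = c} \<in> null_sets M"
      by (rule null_sets_subset[rotated 2]) measurable
    then show ?thesis by (simp add: measure_eq_0_null_sets)
  qed
  show "0 < critical_value M Z \<Psi> \<delta>"
    "prob {\<omega> \<in> space M. critical_value M Z \<Psi> \<delta> \<le> ?X \<omega>} \<le> \<delta>"
    unfolding critical_value_def
    by (rule quantile_attained[OF X nonneg no_atoms \<delta>])+
qed

section \<open>The oracle inequality\<close>

lemma discrepancy_eq:
  assumes "1 \<le> p" "inverse p + inverse q = 1" "\<psi> \<in> Lp_space q" "f \<in> Lp_space p"
    and "aggregate fs l \<in> Lp_space p" and "y \<psi> = pairing \<psi> f + \<xi>"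
  shows "discrepancy fs y l \<psi> = pairing \<psi> (\<lambda>t. f t - aggregate fs l t) + \<xi>"
  using assms by (simp add: discrepancy_def pairing_diff)

text \<open>
  When the noise stays below the critical level, the criterion at any weight \<open>l\<close> is at most the
  approximation error of \<open>l\<close>, by Hoelder's inequality; the subtracted term \<open>\<epsilon> * \<kappa> * Lp_norm 2 \<psi>\<close>
  absorbs the noise. The minimizer inherits this bound, so that both aggregates are close to the
  observation of \<open>\<psi>\<close>, and in the difference of the two discrepancies the observation cancels.
\<close>

lemma discrepancy_minimizer_le:
  fixes fs :: "'n::finite \<Rightarrow> real^'d::finite \<Rightarrow> real"
  assumes p: "1 \<le> p" and pq: "inverse p + inverse q = 1"
    and f: "f \<in> Lp_space p" and F: "\<And>l. aggregate fs l \<in> Lp_space p"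
    and \<Psi>: "finite \<Psi>" "\<Psi> \<subseteq> Lp_space q" "\<And>\<psi>. \<psi> \<in> \<Psi> \<Longrightarrow> 0 < Lp_norm q \<psi>"
    and y: "\<And>\<psi>. \<psi> \<in> \<Psi> \<Longrightarrow> \<bar>y \<psi> - pairing \<psi> f\<bar> \<le> \<epsilon> * \<kappa> * Lp_norm 2 \<psi>"
    and lh: "is_arg_min (criterion q \<epsilon> \<kappa> \<Psi> fs y) (\<lambda>l. l \<in> weights) lh"
    and l: "l \<in> weights" and \<psi>: "\<psi> \<in> \<Psi>"
  shows "\<bar>pairing \<psi> (\<lambda>t. aggregate fs lh t - aggregate fs l t)\<bar> \<le>
    2 * (Lp_norm q \<psi> * Lp_norm p (\<lambda>t. f t - aggregate fs l t)) + 2 * (\<epsilon> * \<kappa> * Lp_norm 2 \<psi>)"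
proof -
  let ?d = "Lp_norm p (\<lambda>t. f t - aggregate fs l t)"
  have disc_l: "\<bar>discrepancy fs y l \<phi>\<bar> \<le> Lp_norm q \<phi> * ?d + \<epsilon> * \<kappa> * Lp_norm 2 \<phi>" if "\<phi> \<in> \<Psi>" for \<phi>
  proof -
    have \<phi>: "\<phi> \<in> Lp_space q" using \<Psi>(2) that by auto
    have "discrepancy fs y l \<phi> = pairing \<phi> (\<lambda>t. f t - aggregate fs l t) + (y \<phi> - pairing \<phi> f)"
      by (rule discrepancy_eq[OF p pq \<phi> f F]) simp
    moreover have "\<bar>pairing \<phi> (\<lambda>t. f t - aggregate fs l t)\<bar> \<le> Lp_norm q \<phi> * ?d"
      by (rule pairing_bound[OF p pq \<phi> Lp_diff(1)[OF p f F]])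
    ultimately show ?thesis using y[OF that] by linarith
  qed
  have ne: "\<Psi> \<noteq> {}" using \<psi> by auto
  have "criterion q \<epsilon> \<kappa> \<Psi> fs y l \<le> ?d"
    unfolding criterion_def
  proof (subst Max_le_iff)
    show "\<forall>a\<in>(\<lambda>\<psi>. 1 / Lp_norm q \<psi> * (\<bar>discrepancy fs y l \<psi>\<bar> - \<epsilon> * \<kappa> * Lp_norm 2 \<psi>)) ` \<Psi>. a \<le> ?d"
    proof clarify
      fix \<phi> assume "\<phi> \<in> \<Psi>"
      then show "1 / Lp_norm q \<phi> * (\<bar>discrepancy fs y l \<phi>\<bar> - \<epsilon> * \<kappa> * Lp_norm 2 \<phi>) \<le> ?d"
        using disc_l[of \<phi>] \<Psi>(3)[of \<phi>] by (simp add: pos_divide_le_eq mult.commute)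
    qed
  qed (use \<Psi>(1) ne in auto)
  moreover have "criterion q \<epsilon> \<kappa> \<Psi> fs y lh \<le> criterion q \<epsilon> \<kappa> \<Psi> fs y l"
    using lh l unfolding is_arg_min_def by (meson not_le)
  moreover have "1 / Lp_norm q \<psi> * (\<bar>discrepancy fs y lh \<psi>\<bar> - \<epsilon> * \<kappa> * Lp_norm 2 \<psi>)
      \<le> criterion q \<epsilon> \<kappa> \<Psi> fs y lh"
    unfolding criterion_def using \<Psi>(1) \<psi> by (intro Max_ge) auto
  ultimately have "1 / Lp_norm q \<psi> * (\<bar>discrepancy fs y lh \<psi>\<bar> - \<epsilon> * \<kappa> * Lp_norm 2 \<psi>) \<le> ?d"
    by linarith
  then have "\<bar>discrepancy fs y lh \<psi>\<bar> \<le> Lp_norm q \<psi> * ?d + \<epsilon> * \<kappa> * Lp_norm 2 \<psi>"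
    using \<Psi>(3)[OF \<psi>] by (simp add: pos_divide_le_eq mult.commute)
  moreover have "pairing \<psi> (\<lambda>t. aggregate fs lh t - aggregate fs l t)
      = discrepancy fs y l \<psi> - discrepancy fs y lh \<psi>"
    using \<psi> \<Psi>(2) F by (simp add: discrepancy_def pairing_diff[OF p pq] subset_iff)
  ultimately show ?thesis using disc_l[OF \<psi>] by linarith
qed

text \<open>
  A difference of aggregates is controlled by its pairings with the probe functions. After moving
  both weights into the net, a probe function recovers the norm of the difference exactly,
  unless it vanishes almost everywhere. Moving costs at most \<open>2 * L * \<epsilon>\<close> in the
  norm, and at most \<open>2 * L * \<epsilon> * Q\<close> in the pairing.
\<close>

lemma norm_le_of_pairings_on_net:
  fixes fs :: "'n::finite \<Rightarrow> real^'d::finite \<Rightarrow> real"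
  assumes p: "1 \<le> p" and pq: "inverse p + inverse q = 1"
    and fs: "\<And>i. fs i \<in> Lp_space p" and L: "\<And>i. Lp_norm p (fs i) \<le> L"
    and net: "l1_net \<epsilon> S"
    and \<Psi>: "\<Psi> \<subseteq> Lp_space q" "good 0 p \<Psi> (differences fs S)"
    and Q: "\<And>\<psi>. \<psi> \<in> \<Psi> \<Longrightarrow> Lp_norm q \<psi> \<le> Q" "0 \<le> Q"
    and lm: "l \<in> weights" "m \<in> weights"
    and B: "\<And>\<psi>. \<psi> \<in> \<Psi> \<Longrightarrow> \<bar>pairing \<psi> (\<lambda>t. aggregate fs l t - aggregate fs m t)\<bar> \<le> B" "0 \<le> B"
  shows "Lp_norm p (\<lambda>t. aggregate fs l t - aggregate fs m t) \<le> B + 2 * L * \<epsilon> * (1 + Q)"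
proof -
  let ?F = "aggregate fs"
  let ?D = "\<lambda>l m t. ?F l t - ?F m t"
  have F [simp]: "?F l \<in> Lp_space p" for l using aggregate_in_Lp_space[of p fs L l, OF p fs L] .
  have D [simp]: "?D l m \<in> Lp_space p" for l m using Lp_diff(1)[OF p F F] .
  have "0 \<le> L" using L Lp_norm_nonneg order_trans by blast
  have near: "\<exists>l'\<in>S. Lp_norm p (?D l l') \<le> L * \<epsilon>" if l: "l \<in> weights" for l
  proof -
    obtain l' where "l' \<in> S" "(\<Sum>i\<in>UNIV. \<bar>l $ i - l' $ i\<bar>) \<le> \<epsilon>"
      using net l unfolding l1_net_def by blast
    moreover have "Lp_norm p (?D l l') \<le> (\<Sum>i\<in>UNIV. \<bar>l $ i - l' $ i\<bar>) * L"
      using aggregate_diff_norm_le[of p fs L l l', OF p fs L] .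
    ultimately show ?thesis
      using mult_right_mono[OF _ \<open>0 \<le> L\<close>] by (metis mult.commute order_trans)
  qed
  obtain l' m' where l': "l' \<in> S" "Lp_norm p (?D l l') \<le> L * \<epsilon>"
    and m': "m' \<in> S" "Lp_norm p (?D m m') \<le> L * \<epsilon>"
    using near lm by blast
  have m'': "Lp_norm p (?D m' m) \<le> L * \<epsilon>" using m' Lp_norm_minus_commute[OF p F F] by simp
  have l'': "Lp_norm p (?D l' l) \<le> L * \<epsilon>" using l' Lp_norm_minus_commute[OF p F F] by simp
  have L\<epsilon>: "0 \<le> L * \<epsilon>" using l'(2) Lp_norm_nonneg order_trans by blast
  have split: "Lp_norm p (?D l m) \<le> Lp_norm p (?D l' m') + 2 * (L * \<epsilon>)"
    using Lp_dist_triangle[OF p F F F, of l m l'] Lp_dist_triangle[OF p F F F, of l' m m'] l' m''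
    by linarith
  have "Lp_norm p (?D l' m') \<le> B + 2 * (L * \<epsilon>) * Q"
  proof (cases "AE t in unit_cube. ?F l' t = ?F m' t")
    case True
    have "Lp_norm p (?D l' m') = 0"
    proof (rule Lp_norm_AE_zero(2)[OF p Lp_space_measurable[OF D]])
      show "AE t in unit_cube. ?D l' m' t = 0" using True by eventually_elim simp
    qed
    then show ?thesis using B(2) Q(2) L\<epsilon> by simp
  next
    case False
    then have "l' \<noteq> m'" by auto
    with False l'(1) m'(1) have "?D l' m' \<in> differences fs S" unfolding differences_def by blast
    then obtain \<psi> where \<psi>: "\<psi> \<in> \<Psi>" "represents 0 p \<psi> (?D l' m')"
      using \<Psi>(2) unfolding good_def by blast
    have \<psi>q: "\<psi> \<in> Lp_space q" using \<psi>(1) \<Psi>(1) by auto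
    have small: "\<bar>pairing \<psi> (?D a b)\<bar> \<le> (L * \<epsilon>) * Q" if "Lp_norm p (?D a b) \<le> L * \<epsilon>" for a b
    proof -
      have "\<bar>pairing \<psi> (?D a b)\<bar> \<le> Lp_norm q \<psi> * Lp_norm p (?D a b)"
        by (rule pairing_bound[OF p pq \<psi>q D])
      also have "\<dots> \<le> Q * (L * \<epsilon>)"
        by (intro mult_mono Q(1)[OF \<psi>(1)] that Q(2) Lp_norm_nonneg)
      finally show ?thesis by (simp add: mult.commute)
    qed
    have "Lp_norm p (?D l' m') = pairing \<psi> (?D l' m')" using \<psi>(2) by (simp add: represents_def)
    also have "\<dots> = pairing \<psi> (?D l' l) + pairing \<psi> (?D l m) + pairing \<psi> (?D m m')"
      by (simp add: pairing_diff[OF p pq \<psi>q])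
    also have "\<dots> \<le> (L * \<epsilon>) * Q + B + (L * \<epsilon>) * Q"
      using small[OF l''] small[OF m'(2)] B(1)[OF \<psi>(1)] by linarith
    finally show ?thesis by (simp add: algebra_simps)
  qed
  with split show ?thesis by (simp add: algebra_simps)
qed

theorem theorem5:
  fixes M :: "'w measure"
    and Z :: "(real^'d::finite \<Rightarrow> real) \<Rightarrow> 'w \<Rightarrow> real"
    and f :: "real^'d \<Rightarrow> real"
    and fs :: "'n::finite \<Rightarrow> real^'d \<Rightarrow> real"
    and p q :: ennreal
    and \<epsilon> \<delta> L \<kappa> :: real
    and net :: "(real^'n) set"
    and \<Psi> :: "(real^'d \<Rightarrow> real) set"
    and lhat :: "'w \<Rightarrow> real^'n"
  assumes "0 < \<epsilon>" and "\<epsilon> < 1"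
    and "white_noise M Z"
    and "1 \<le> p" and "inverse p + inverse q = 1"
    and "f \<in> Lp_space p" and "\<And>i. fs i \<in> Lp_space p"
    and "L = Max (insert (Lp_norm p f) (range (\<lambda>i. Lp_norm p (fs i))))"
    and "minimal_l1_net \<epsilon> net"
    and "finite \<Psi>" and "\<Psi> \<noteq> {}"
    and "\<Psi> \<subseteq> Lp_space 2" and "\<Psi> \<subseteq> Lp_space q"
    and "\<And>\<psi>. \<psi> \<in> \<Psi> \<Longrightarrow> \<not> (AE t in unit_cube. \<psi> t = 0)"
    and "consists_of_representers 0 p \<Psi> (differences fs net)"
    and "good 0 p \<Psi> (differences fs net)"
    and "0 < \<delta>" and "\<delta> < 1"
    and "\<kappa> = critical_value M Z \<Psi> \<delta>"
    and "lhat \<in> borel_measurable M"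
    and "\<And>\<omega>. \<omega> \<in> space M \<Longrightarrow>
           is_arg_min (criterion q \<epsilon> \<kappa> \<Psi> fs (\<lambda>\<psi>. observation Z \<epsilon> f \<psi> \<omega>))
             (\<lambda>l. l \<in> weights) (lhat \<omega>)"
  shows "risk M p (\<lambda>\<omega>. aggregate fs (lhat \<omega>)) f \<le> ennreal (
           (2 * (MAX \<psi>\<in>\<Psi>. Lp_norm q \<psi>) + 1) *
             (LEAST r. r \<in> (\<lambda>l. Lp_norm p (\<lambda>t. f t - aggregate fs l t)) ` weights)
           + 2 * \<kappa> * \<epsilon> * (MAX \<psi>\<in>\<Psi>. Lp_norm 2 \<psi>)
           + 2 * L * \<epsilon> * (1 + (MAX \<psi>\<in>\<Psi>. Lp_norm q \<psi>))
           + 2 * L * \<delta>)"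
proof -
  note \<epsilon> = \<open>0 < \<epsilon>\<close> and wn = \<open>white_noise M Z\<close> and p = \<open>1 \<le> p\<close>
    and pq = \<open>inverse p + inverse q = 1\<close> and f = \<open>f \<in> Lp_space p\<close>
    and fs = \<open>\<And>i. fs i \<in> Lp_space p\<close> and fin = \<open>finite \<Psi>\<close> and ne = \<open>\<Psi> \<noteq> {}\<close>
    and nonzero = \<open>\<And>\<psi>. \<psi> \<in> \<Psi> \<Longrightarrow> \<not> (AE t in unit_cube. \<psi> t = 0)\<close>
    and lhat = \<open>\<And>\<omega>. \<omega> \<in> space M \<Longrightarrow>
           is_arg_min (criterion q \<epsilon> \<kappa> \<Psi> fs (\<lambda>\<psi>. observation Z \<epsilon> f \<psi> \<omega>))
             (\<lambda>l. l \<in> weights) (lhat \<omega>)\<close>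
  interpret prob_space M using wn by (simp add: white_noise_def)
  let ?F = "aggregate fs"
  define Q where "Q = (MAX \<psi>\<in>\<Psi>. Lp_norm q \<psi>)"
  define T where "T = (MAX \<psi>\<in>\<Psi>. Lp_norm 2 \<psi>)"
  obtain l where l: "l \<in> weights" and d: "Lp_norm p (\<lambda>t. f t - ?F l t) =
      (LEAST r. r \<in> (\<lambda>l. Lp_norm p (\<lambda>t. f t - ?F l t)) ` weights)"
    using best_aggregate_exists[OF p fs f] .
  let ?d = "Lp_norm p (\<lambda>t. f t - ?F l t)"
  define B where "B = (2 * Q + 1) * ?d + 2 * \<kappa> * \<epsilon> * T + 2 * L * \<epsilon> * (1 + Q)"
  define bad where "bad = {\<omega> \<in> space M. \<kappa> \<le> (MAX \<psi>\<in>\<Psi>. \<bar>Z \<psi> \<omega>\<bar> / Lp_norm 2 \<psi>)}"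
  have Lf: "Lp_norm p f \<le> L" and L: "Lp_norm p (fs i) \<le> L" for i
    unfolding \<open>L = _\<close> by (rule Max_ge; simp)+
  have L0: "0 \<le> L" using Lf Lp_norm_nonneg order_trans by blast
  have \<kappa>: "0 < \<kappa>" and bad_prob: "prob bad \<le> \<delta>"
    using critical_value_controls_noise[OF wn fin ne \<open>\<Psi> \<subseteq> Lp_space 2\<close> nonzero \<open>0 < \<delta>\<close> \<open>\<delta> < 1\<close>] \<open>\<kappa> = _\<close>
    by (auto simp: bad_def)
  have q: "1 \<le> q" using conjugate_exponent_ge_1[OF p pq] .
  have pos: "0 < Lp_norm r \<psi>" if "\<psi> \<in> \<Psi>" "1 \<le> r" "\<Psi> \<subseteq> Lp_space r" for r \<psi>
    using Lp_norm_eq_0_imp_AE[of r \<psi>] Lp_norm_nonneg[of r \<psi>] nonzero[OF that(1)] that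
    by (auto simp: less_le)
  have pos_q: "0 < Lp_norm q \<psi>" and pos_2: "0 < Lp_norm 2 \<psi>" if "\<psi> \<in> \<Psi>" for \<psi>
    using pos that q \<open>\<Psi> \<subseteq> Lp_space 2\<close> \<open>\<Psi> \<subseteq> Lp_space q\<close> by auto
  have Q: "Lp_norm q \<psi> \<le> Q" and T: "Lp_norm 2 \<psi> \<le> T" if "\<psi> \<in> \<Psi>" for \<psi>
    using that fin by (auto simp: Q_def T_def)
  obtain \<psi>\<^sub>0 where "\<psi>\<^sub>0 \<in> \<Psi>" using ne by blast
  then have Q0: "0 \<le> Q" and T0: "0 \<le> T"
    using Q[of \<psi>\<^sub>0] T[of \<psi>\<^sub>0] Lp_norm_nonneg[of q \<psi>\<^sub>0] Lp_norm_nonneg[of 2 \<psi>\<^sub>0] by auto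
  have F: "?F m \<in> Lp_space p" for m using aggregate_in_Lp_space[of p fs L m, OF p fs L] .
  have B0: "0 \<le> B"
    unfolding B_def using Q0 T0 L0 \<kappa> \<epsilon> by (intro add_nonneg_nonneg mult_nonneg_nonneg Lp_norm_nonneg) auto
  have good_event: "Lp_norm p (\<lambda>t. ?F (lhat \<omega>) t - f t) \<le> B" if \<omega>: "\<omega> \<in> space M" "\<omega> \<notin> bad" for \<omega>
  proof -
    have w: "lhat \<omega> \<in> weights" using lhat[OF \<omega>(1)] by (simp add: is_arg_min_def)
    have noise: "\<bar>observation Z \<epsilon> f \<psi> \<omega> - pairing \<psi> f\<bar> \<le> \<epsilon> * \<kappa> * Lp_norm 2 \<psi>" if "\<psi> \<in> \<Psi>" for \<psi>
    proof -
      have "\<bar>Z \<psi> \<omega>\<bar> / Lp_norm 2 \<psi> \<le> (MAX \<psi>\<in>\<Psi>. \<bar>Z \<psi> \<omega>\<bar> / Lp_norm 2 \<psi>)"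
        using fin that by (intro Max_ge) auto
      also have "\<dots> \<le> \<kappa>" using \<omega> by (auto simp: bad_def)
      finally have "\<bar>Z \<psi> \<omega>\<bar> \<le> \<kappa> * Lp_norm 2 \<psi>" using pos_2[OF that] by (simp add: pos_divide_le_eq)
      then show ?thesis using \<epsilon> by (simp add: observation_def abs_mult mult.assoc)
    qed
    have pairings: "\<bar>pairing \<psi> (\<lambda>t. ?F (lhat \<omega>) t - ?F l t)\<bar> \<le> 2 * (Q * ?d) + 2 * (\<epsilon> * \<kappa> * T)"
      if \<psi>: "\<psi> \<in> \<Psi>" for \<psi>
    proof -
      have "\<bar>pairing \<psi> (\<lambda>t. ?F (lhat \<omega>) t - ?F l t)\<bar>
          \<le> 2 * (Lp_norm q \<psi> * ?d) + 2 * (\<epsilon> * \<kappa> * Lp_norm 2 \<psi>)"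
        by (rule discrepancy_minimizer_le[OF p pq f F fin \<open>\<Psi> \<subseteq> Lp_space q\<close> pos_q noise lhat[OF \<omega>(1)] l \<psi>])
      also have "\<dots> \<le> 2 * (Q * ?d) + 2 * (\<epsilon> * \<kappa> * T)"
        using Q[OF \<psi>] T[OF \<psi>] \<epsilon> \<kappa> Lp_norm_nonneg
        by (intro add_mono mult_left_mono mult_right_mono) auto
      finally show ?thesis .
    qed
    have "Lp_norm p (\<lambda>t. ?F (lhat \<omega>) t - ?F l t) \<le> 2 * (Q * ?d) + 2 * (\<epsilon> * \<kappa> * T) + 2 * L * \<epsilon> * (1 + Q)"
    proof (rule norm_le_of_pairings_on_net[OF p pq fs L _ \<open>\<Psi> \<subseteq> Lp_space q\<close>
          \<open>good 0 p \<Psi> (differences fs net)\<close> Q Q0 w l pairings])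
      show "l1_net \<epsilon> net" using \<open>minimal_l1_net \<epsilon> net\<close> by (simp add: minimal_l1_net_def)
      show "0 \<le> 2 * (Q * ?d) + 2 * (\<epsilon> * \<kappa> * T)"
        using Q0 T0 \<kappa> \<epsilon> by (intro add_nonneg_nonneg mult_nonneg_nonneg Lp_norm_nonneg) auto
    qed
    moreover have "Lp_norm p (\<lambda>t. ?F (lhat \<omega>) t - f t) \<le>
        Lp_norm p (\<lambda>t. ?F (lhat \<omega>) t - ?F l t) + Lp_norm p (\<lambda>t. ?F l t - f t)"
      by (rule Lp_dist_triangle[OF p F F f])
    ultimately show ?thesis
      using Lp_norm_minus_commute[OF p F f, of l] by (simp add: B_def algebra_simps)
  qed
  \<comment> \<open>Where the noise is large, only the size of the functions is known.\<close>
  have trivial_bound: "Lp_norm p (\<lambda>t. ?F (lhat \<omega>) t - f t) \<le> 2 * L" if "\<omega> \<in> space M" for \<omega>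
  proof -
    have "lhat \<omega> \<in> weights" using lhat[OF that] by (simp add: is_arg_min_def)
    then show ?thesis
      using Lp_diff(2)[OF p F f, of "lhat \<omega>"] aggregate_norm_le[of p fs L "lhat \<omega>", OF p fs L] Lf
      by linarith
  qed
  have bad_sets [measurable]: "bad \<in> sets M"
    unfolding bad_def
    using max_noise_measurable[OF wn fin \<open>\<Psi> \<subseteq> Lp_space 2\<close> nonzero] by measurable
  \<comment> \<open>The integral is monotone on all functions, so the loss can be compared with a simple
    function before its measurability is settled.\<close>
  have "risk M p (\<lambda>\<omega>. ?F (lhat \<omega>)) f \<le> (\<integral>\<^sup>+\<omega>. ennreal B + ennreal (2 * L) * indicator bad \<omega> \<partial>M)"
    unfolding risk_def
  proof (rule nn_integral_mono)
    fix \<omega> assume \<omega>: "\<omega> \<in> space M"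
    show "ennreal (Lp_norm p (\<lambda>t. ?F (lhat \<omega>) t - f t))
        \<le> ennreal B + ennreal (2 * L) * indicator bad \<omega>"
      using trivial_bound[OF \<omega>] good_event[OF \<omega>] B0
      by (cases "\<omega> \<in> bad") (auto intro: ennreal_leI add_increasing)
  qed
  also have "\<dots> = ennreal B + ennreal (2 * L) * emeasure M bad"
    by (subst nn_integral_add) (auto simp: nn_integral_cmult_indicator emeasure_space_1)
  also have "\<dots> = ennreal (B + 2 * L * prob bad)"
    using B0 L0 by (simp add: emeasure_eq_measure ennreal_mult ennreal_plus)
  also have "\<dots> \<le> ennreal (B + 2 * L * \<delta>)"
    using bad_prob L0 by (intro ennreal_leI add_left_mono mult_left_mono) auto
  finally show ?thesis by (simp add: B_def Q_def T_def d)
qed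

end
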